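(* Let $G$ be a trunc, identified with its Madden representation as a subtrunc of $\mathcal R_0L$. If $\{g_n\}_{n\ge1}\subseteq G^+$ is a truncation sequence, then the sequence of differences $\{g_n-g_{n-1}\}_{n\ge1}$ (with $g_0=0$) is a good sequence; and if $\{f_n\}_{n\ge1}$ is a good sequence, then the sequence of partial sums $\big\{\sum_{1\le n\le m}f_n\big\}_{m\ge1}$ is a truncation sequence. Thus the truncation sequences in $G$ are in bijective correspondence with the good sequences in $G$.
   Context: All vector lattices are real. A truncation on an archimedean vector lattice $G$ is a unary operation $g\mapsto\overline g$ on $G^+$ such that for all $g,h\in G^+$: $g\wedge\overline h\le\overline g\le g$; if $\overline g=0$ then $g=0$; if $ng=\overline{ng}$ for all positive integers $n$ then $g=0$. A trunc is an archimedean vector lattice with a truncation. $\overline G=\{\overline g:g\in G^+\}$. For $g\in G^+$ and a positive integer $n$, $g\wedge n$ abbreviates $n\,\overline{g/n}$ ($n$ is formal). A pointed frame is a frame $L$ with a frame homomorphism $*_L\colon L\to2=\{\bot,\top\}$; pointed frame homomorphisms commute with the points. $\mathcal O_*\mathbb R$, $\mathcal O_*\overline{\mathbb R}$ are the frames of open sets of $\mathbb R$ and $\overline{\mathbb R}=[-\infty,\infty]$ pointed by $0$; $p\colon\mathcal O_*\overline{\mathbb R}\to\mathcal O_*\mathbb R$ is $U\mapsto U\cap(-\infty,\infty)$. $\mathcal R_0L$ is the set of pointed frame homomorphisms $\mathcal O_*\mathbb R\to L$; it is a trunc, each operation $w\colon\mathbb R^n\to\mathbb R$ (addition, scalar multiplication,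 $\vee$, $\wedge$, truncation $x\mapsto x\wedge1$) acting by $w(f_1,\dots,f_n)(V)=\bigvee\{\bigwedge_if_i(U_i):w(U_1\times\dots\times U_n)\subseteq V\}$. Madden representation: every trunc $G$ is isomorphic to a subtrunc of $\mathcal R_0L$ where $q\colon M\to L$ is a dense surjective pointed frame homomorphism with $M$ compact regular, such that every $g\in G\subseteq\mathcal R_0L$ has a (unique) pointed frame homomorphism $g'\colon\mathcal O_*\overline{\mathbb R}\to M$ with $q\circ g'=g\circ p$; every element of $M$ is a join of elements $g'(0,\infty]$ and $g'[-\infty,1)$, $g\in\overline G$; and the sublocale $q_*(L)$ is the intersection of the open sublocales $g'(-\infty,\infty)\to M=\{g'(-\infty,\infty)\to x:x\in M\}$, $g\in G$. This is unique up to isomorphism. A sequence $\{g_n\}_{n\ge1}\subseteq G^+$ is a truncation sequence if $g_n=g_{n+1}\wedge n$ for all $n$ and $\bigvee_ng_n(-\infty,n)=\top$ in $L$ (equivalently, there is $g\in\mathcal R_0L$, $g\ge0$, with $g_n=g\wedge n$ for all $n$). A sequence $\{f_n\}_{n\ge1}\subseteq\overline G$ is a good sequence if $f_n=\overline{f_n+f_{n+1}}$ for all $n$ and $f_n\searrow0$. Here $g_n\searrow g_0$ means $g_{n+1}\le g_n$ for all $n$ and $\bigvee_ng_n(-\infty,r)=g_0(-\infty,r)$ for all $r\in\mathbb R$. *)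

theory Defs
  imports "HOL-Analysis.Analysis" "HOL-Library.Lattice_Algebras" "HOL-Library.FuncSet"
begin

section \<open>Truncs\<close>

class archimedean_vector_lattice = ordered_real_vector + lattice_ab_group_add +
  assumes archimedean: "0 \<le> x \<Longrightarrow> 0 \<le> y \<Longrightarrow> (\<And>n::nat. real n *\<^sub>R x \<le> y) \<Longrightarrow> x = 0"

text \<open>
  A truncation is an operation on the positive cone only: the axioms say nothing about the
  values of \<open>truncate\<close> at elements that are not positive, and these values are never used.
\<close>
class trunc = archimedean_vector_lattice +
  fixes truncate :: "'a \<Rightarrow> 'a"
  assumes truncate_nonneg: "0 \<le> g \<Longrightarrow> 0 \<le> truncate g"
    and inf_truncate_le: "0 \<le> g \<Longrightarrow> 0 \<le> h \<Longrightarrow> inf g (truncate h) \<le> truncate g"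
    and truncate_le: "0 \<le> g \<Longrightarrow> truncate g \<le> g"
    and truncate_eq_0: "0 \<le> g \<Longrightarrow> truncate g = 0 \<Longrightarrow> g = 0"
    and truncate_unbounded: "0 \<le> g \<Longrightarrow>
      (\<And>n::nat. 1 \<le> n \<Longrightarrow> real n *\<^sub>R g = truncate (real n *\<^sub>R g)) \<Longrightarrow> g = 0"

definition truncated :: "'g::trunc set" where
  "truncated = truncate ` {g. 0 \<le> g}"

text \<open>The formal infimum \<open>g \<and> n\<close> of a positive element and a positive integer.\<close>
definition inf_nat :: "'g::trunc \<Rightarrow> nat \<Rightarrow> 'g" where
  "inf_nat g n = real n *\<^sub>R truncate (g /\<^sub>R real n)"


section \<open>Pointed frames\<close>

class frame = complete_lattice +
  assumes inf_Sup_frame: "inf x (Sup A) = (SUP a\<in>A. inf x a)"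

definition frame_hom :: "('a::frame \<Rightarrow> 'b::frame) \<Rightarrow> bool" where
  "frame_hom h \<longleftrightarrow>
     h top = top \<and> (\<forall>x y. h (inf x y) = inf (h x) (h y)) \<and> (\<forall>A. h (Sup A) = Sup (h ` A))"

instance bool :: frame
  by standard auto

class pointed_frame = frame +
  fixes basepoint :: "'a \<Rightarrow> bool"
  assumes basepoint_top: "basepoint top"
    and basepoint_inf: "basepoint (inf x y) \<longleftrightarrow> basepoint x \<and> basepoint y"
    and basepoint_Sup: "basepoint (Sup A) \<longleftrightarrow> (\<exists>a\<in>A. basepoint a)"

lemma frame_hom_basepoint: "frame_hom (basepoint :: 'a::pointed_frame \<Rightarrow> bool)"
  by (simp add: frame_hom_def basepoint_top basepoint_inf basepoint_Sup)

definition pointed_frame_hom :: "('a::pointed_frame \<Rightarrow> 'b::pointed_frame) \<Rightarrow> bool" where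
  "pointed_frame_hom h \<longleftrightarrow> frame_hom h \<and> (\<forall>x. basepoint (h x) = basepoint x)"

definition dense_hom :: "('a::frame \<Rightarrow> 'b::frame) \<Rightarrow> bool" where
  "dense_hom h \<longleftrightarrow> (\<forall>x. h x = bot \<longrightarrow> x = bot)"

definition compact_frame :: "'a::frame itself \<Rightarrow> bool" where
  "compact_frame _ \<longleftrightarrow> (\<forall>A::'a set. Sup A = top \<longrightarrow> (\<exists>B\<subseteq>A. finite B \<and> Sup B = top))"

text \<open>Heyting implication.\<close>
definition imp :: "'a::frame \<Rightarrow> 'a \<Rightarrow> 'a" where
  "imp x y = Sup {z. inf z x \<le> y}"

text \<open>\<open>x\<close> is rather below \<open>y\<close>: the pseudocomplement of \<open>x\<close> joined with \<open>y\<close> is top.\<close>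
definition rather_below :: "'a::frame \<Rightarrow> 'a \<Rightarrow> bool" where
  "rather_below x y \<longleftrightarrow> sup (imp x bot) y = top"

definition regular_frame :: "'a::frame itself \<Rightarrow> bool" where
  "regular_frame _ \<longleftrightarrow> (\<forall>x::'a. x = Sup {y. rather_below y x})"

definition right_adjoint :: "('a::frame \<Rightarrow> 'b::frame) \<Rightarrow> 'b \<Rightarrow> 'a" where
  "right_adjoint h y = Sup {x. h x \<le> y}"

definition open_sublocale :: "'a::frame \<Rightarrow> 'a set" where
  "open_sublocale x = range (imp x)"


section \<open>Frames of open sets\<close>

typedef (overloaded) 'a opens = "{U :: 'a::topological_space set. open U}"
  morphisms points_of Opens
  by auto

lemma open_points_of [simp]: "open (points_of U)"
  using points_of by auto

lemma points_of_Opens [simp]: "open U \<Longrightarrow> points_of (Opens U) = U"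
  by (simp add: Opens_inverse)

instantiation opens :: (topological_space) complete_lattice
begin

definition less_eq_opens :: "'a opens \<Rightarrow> 'a opens \<Rightarrow> bool" where
  "U \<le> V \<longleftrightarrow> points_of U \<subseteq> points_of V"
definition less_opens :: "'a opens \<Rightarrow> 'a opens \<Rightarrow> bool" where
  "U < V \<longleftrightarrow> points_of U \<subset> points_of V"
definition inf_opens :: "'a opens \<Rightarrow> 'a opens \<Rightarrow> 'a opens" where
  "inf U V = Opens (points_of U \<inter> points_of V)"
definition sup_opens :: "'a opens \<Rightarrow> 'a opens \<Rightarrow> 'a opens" where
  "sup U V = Opens (points_of U \<union> points_of V)"
definition bot_opens :: "'a opens" where
  "bot = Opens {}"
definition top_opens :: "'a opens" where
  "top = Opens UNIV"
definition Sup_opens :: "'a opens set \<Rightarrow> 'a opens" where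
  "Sup \<U> = Opens (\<Union> (points_of ` \<U>))"
definition Inf_opens :: "'a opens set \<Rightarrow> 'a opens" where
  "Inf \<U> = Opens (interior (\<Inter> (points_of ` \<U>)))"

instance
proof
  fix U V W :: "'a opens" and \<U> :: "'a opens set"
  show "U \<in> \<U> \<Longrightarrow> Inf \<U> \<le> U"
    using interior_subset by (fastforce simp: less_eq_opens_def Inf_opens_def)
  show "(\<And>V. V \<in> \<U> \<Longrightarrow> U \<le> V) \<Longrightarrow> U \<le> Inf \<U>"
    by (simp add: less_eq_opens_def Inf_opens_def interior_maximal INF_greatest)
qed (auto simp: less_eq_opens_def less_opens_def inf_opens_def sup_opens_def bot_opens_def
    top_opens_def Sup_opens_def Inf_opens_def open_Int open_Un open_UN points_of_inject)

end

lemma points_of_simps [simp]: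
  "points_of (inf U V) = points_of U \<inter> points_of V"
  "points_of (sup U V) = points_of U \<union> points_of V"
  "points_of bot = {}"
  "points_of top = UNIV"
  "points_of (Sup \<U>) = \<Union> (points_of ` \<U>)"
  by (auto simp: inf_opens_def sup_opens_def bot_opens_def top_opens_def Sup_opens_def open_Int open_Un open_UN)

instance opens :: (topological_space) frame
  by standard (auto simp: points_of_inject [symmetric])

instantiation opens :: ("{topological_space, zero}") pointed_frame
begin

definition basepoint_opens :: "'a opens \<Rightarrow> bool" where
  "basepoint U \<longleftrightarrow> 0 \<in> points_of U"

instance
  by standard (auto simp: basepoint_opens_def)

end

definition restrict_real :: "ereal opens \<Rightarrow> real opens" where
  "restrict_real U = Opens (ereal -` points_of U)"


section \<open>The pointed frame homomorphisms from the frame of the reals\<close>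

definition R0 :: "(real opens \<Rightarrow> 'l::pointed_frame) set" where
  "R0 = {f. pointed_frame_hom f}"

definition lift1 ::
    "(real \<Rightarrow> real) \<Rightarrow> (real opens \<Rightarrow> 'l::pointed_frame) \<Rightarrow> real opens \<Rightarrow> 'l" where
  "lift1 w f V = Sup {f U | U. w ` points_of U \<subseteq> points_of V}"

definition lift2 :: "(real \<Rightarrow> real \<Rightarrow> real) \<Rightarrow>
    (real opens \<Rightarrow> 'l::pointed_frame) \<Rightarrow> (real opens \<Rightarrow> 'l) \<Rightarrow> real opens \<Rightarrow> 'l" where
  "lift2 w f\<^sub>1 f\<^sub>2 V = Sup {inf (f\<^sub>1 U\<^sub>1) (f\<^sub>2 U\<^sub>2) | U\<^sub>1 U\<^sub>2.
     (\<lambda>(x, y). w x y) ` (points_of U\<^sub>1 \<times> points_of U\<^sub>2) \<subseteq> points_of V}"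


section \<open>Madden representations\<close>

text \<open>
  \<open>\<phi>\<close> is the isomorphism of the trunc \<open>'g\<close> onto a subtrunc of \<open>R0\<close>, and \<open>ext g\<close> is the
  homomorphism written \<open>g'\<close> in the literature. It is determined by \<open>g\<close>, since \<open>q\<close> is dense and
  the frame of open sets of the extended reals is regular.
\<close>
locale madden_representation =
  fixes \<phi> :: "'g::trunc \<Rightarrow> real opens \<Rightarrow> 'l::pointed_frame"
    and q :: "'m::pointed_frame \<Rightarrow> 'l"
    and ext :: "'g \<Rightarrow> ereal opens \<Rightarrow> 'm"
  assumes inj_rep: "inj \<phi>"
    and rep_R0: "\<phi> g \<in> R0"
    and rep_add: "\<phi> (g + h) = lift2 (+) (\<phi> g) (\<phi> h)"
    and rep_scaleR: "\<phi> (c *\<^sub>R g) = lift1 ((*) c) (\<phi> g)"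
    and rep_sup: "\<phi> (sup g h) = lift2 max (\<phi> g) (\<phi> h)"
    and rep_inf: "\<phi> (inf g h) = lift2 min (\<phi> g) (\<phi> h)"
    and rep_truncate: "0 \<le> g \<Longrightarrow> \<phi> (truncate g) = lift1 (\<lambda>x. min x 1) (\<phi> g)"
    and hom_q: "pointed_frame_hom q"
    and dense_q: "dense_hom q"
    and surj_q: "surj q"
    and compact_M: "compact_frame TYPE('m)"
    and regular_M: "regular_frame TYPE('m)"
    and hom_ext: "pointed_frame_hom (ext g)"
    and q_ext: "q \<circ> ext g = \<phi> g \<circ> restrict_real"
    and generated_M: "\<exists>A. A \<subseteq> (\<lambda>g. ext g (Opens {0<..})) ` truncated
                            \<union> (\<lambda>g. ext g (Opens {..<1})) ` truncated \<and> x = Sup A"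
    and sublocale_L: "range (right_adjoint q)
                        = (\<Inter>g. open_sublocale (ext g (Opens {-\<infinity><..<\<infinity>})))"


section \<open>Truncation sequences and good sequences\<close>

text \<open>
  Sequences are indexed by the positive integers, i.e. they are extensional functions on
  \<open>{1..}\<close>. A trunc is identified with a subset of \<open>R0\<close> through \<open>\<phi>\<close>, so that \<open>g(U)\<close> is
  written \<open>\<phi> g U\<close>.
\<close>

definition truncation_sequence ::
    "('g::trunc \<Rightarrow> real opens \<Rightarrow> 'l::pointed_frame) \<Rightarrow> (nat \<Rightarrow> 'g) \<Rightarrow> bool" where
  "truncation_sequence \<phi> g \<longleftrightarrow>
     g \<in> {1..} \<rightarrow>\<^sub>E {x. 0 \<le> x} \<and>
     (\<forall>n\<ge>1. g n = inf_nat (g (n + 1)) n) \<and>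
     (SUP n\<in>{1..}. \<phi> (g n) (Opens {..<real n})) = top"

definition decreases_to :: "('g::trunc \<Rightarrow> real opens \<Rightarrow> 'l::pointed_frame) \<Rightarrow>
    (nat \<Rightarrow> 'g) \<Rightarrow> 'g \<Rightarrow> bool" where
  "decreases_to \<phi> g g\<^sub>0 \<longleftrightarrow>
     (\<forall>n\<ge>1. g (n + 1) \<le> g n) \<and>
     (\<forall>r::real. (SUP n\<in>{1..}. \<phi> (g n) (Opens {..<r})) = \<phi> g\<^sub>0 (Opens {..<r}))"

definition good_sequence ::
    "('g::trunc \<Rightarrow> real opens \<Rightarrow> 'l::pointed_frame) \<Rightarrow> (nat \<Rightarrow> 'g) \<Rightarrow> bool" where
  "good_sequence \<phi> f \<longleftrightarrow>
     f \<in> {1..} \<rightarrow>\<^sub>E truncated \<and>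
     (\<forall>n\<ge>1. f n = truncate (f n + f (n + 1))) \<and>
     decreases_to \<phi> f 0"

definition differences :: "(nat \<Rightarrow> 'g::trunc) \<Rightarrow> nat \<Rightarrow> 'g" where
  "differences g = (\<lambda>n\<in>{1..}. g n - (if n = 1 then 0 else g (n - 1)))"

definition partial_sums :: "(nat \<Rightarrow> 'g::trunc) \<Rightarrow> nat \<Rightarrow> 'g" where
  "partial_sums f = (\<lambda>m\<in>{1..}. \<Sum>n=1..m. f n)"

end

theory Submission
  imports Defs
begin

text \<open>
  Elements of \<open>R0\<close> are computed pointwise although \<open>L\<close> need not have points: if they are
  pullbacks of continuous functions along one frame homomorphism \<open>h\<close> from the open sets of a
  space, then the operations act on these functions, and an equation between two of them makes
  \<open>h\<close> vanish on the open set where the functions differ. For differences of a truncation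
  sequence all functions depend on one variable, the value of \<open>g\<^bsub>n+1\<^esub>\<close>. For partial sums
  of a good sequence two variables suffice, the values of the \<open>m\<close>-th partial sum and of
  \<open>f\<^bsub>m+1\<^esub>\<close>, since local compactness of the line extends two homomorphisms to the plane.
\<close>

section \<open>Frame homomorphisms\<close>

text \<open>Distributing the meet over one join and then over the other leaves meets of two members
  only.\<close>

lemma inf_Sup_Sup_le:
  fixes c :: "'a::frame"
  assumes "\<And>a b. a \<in> A \<Longrightarrow> b \<in> B \<Longrightarrow> inf a b \<le> c"
  shows "inf (Sup A) (Sup B) \<le> c"
proof -
  have "inf (Sup A) b \<le> c" if "b \<in> B" for b
    unfolding inf_commute[of "Sup A"] inf_Sup_frame
    using assms that by (auto simp: inf_commute intro!: SUP_least)
  then show ?thesis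
    by (auto simp: inf_Sup_frame intro!: SUP_least)
qed

lemma frame_homD:
  assumes "frame_hom h"
  shows "h top = top" "h (inf x y) = inf (h x) (h y)" "h (Sup A) = Sup (h ` A)"
  using assms by (auto simp: frame_hom_def)

lemma frame_hom_bot: "frame_hom h \<Longrightarrow> h bot = bot"
  using frame_homD(3)[of h "{}"] by simp

lemma frame_hom_sup: "frame_hom h \<Longrightarrow> h (sup x y) = sup (h x) (h y)"
  using frame_homD(3)[of h "{x, y}"] by simp

lemma frame_hom_mono: "frame_hom h \<Longrightarrow> x \<le> y \<Longrightarrow> h x \<le> h y"
  by (metis frame_hom_sup le_iff_sup)

text \<open>Coverings of open sets, checked at points, pass to the target frame in this
  form.\<close>

lemma frame_hom_le_Sup: "frame_hom h \<Longrightarrow> x \<le> Sup A \<Longrightarrow> h x \<le> Sup (h ` A)"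
  by (metis frame_hom_mono frame_homD(3))

lemma opens_eqI: "points_of U = points_of V \<Longrightarrow> U = V"
  by (simp add: points_of_inject)

section \<open>Pullbacks along continuous functions\<close>

text \<open>\<open>Opens\<close> is unspecified on sets that are not open, whence the continuity
  premises in the lemmas on \<open>preimage\<close>.\<close>

definition preimage :: "('x::topological_space \<Rightarrow> real) \<Rightarrow> real opens \<Rightarrow> 'x opens" where
  "preimage w V = Opens (w -` points_of V)"

lemma points_of_preimage [simp]:
  "continuous_on UNIV w \<Longrightarrow> points_of (preimage w V) = w -` points_of V"
  by (simp add: preimage_def open_vimage)

text \<open>The largest open \<open>U\<close> that \<open>c\<close> maps into \<open>V\<close> is
  the preimage of \<open>V\<close> under \<open>c\<close>, so the join is attained there.\<close>

lemma lift1_preimage: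
  assumes h: "frame_hom h" and w: "continuous_on UNIV w" and c: "continuous_on UNIV c"
  shows "lift1 c (h \<circ> preimage w) = h \<circ> preimage (\<lambda>x. c (w x))"
proof
  fix V
  have cw: "continuous_on UNIV (\<lambda>x. c (w x))"
    using continuous_on_compose2[OF c w] by simp
  show "lift1 c (h \<circ> preimage w) V = (h \<circ> preimage (\<lambda>x. c (w x))) V"
    unfolding lift1_def
  proof (rule antisym)
    show "Sup {(h \<circ> preimage w) U |U. c ` points_of U \<subseteq> points_of V} \<le> (h \<circ> preimage (\<lambda>x. c (w x))) V"
      by (rule Sup_least) (force intro!: frame_hom_mono[OF h] simp: less_eq_opens_def w cw)
    have "preimage (\<lambda>x. c (w x)) V = preimage w (preimage c V)"
      by (rule opens_eqI) (auto simp: w c cw)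
    then show "(h \<circ> preimage (\<lambda>x. c (w x))) V \<le> Sup {(h \<circ> preimage w) U |U. c ` points_of U \<subseteq> points_of V}"
      by (auto intro!: Sup_upper exI[of _ "preimage c V"] simp: c)
  qed
qed

text \<open>Open rectangles form a base of the plane, so the open preimage of \<open>V\<close> under
  \<open>c\<close> is the union of the rectangles that define \<open>lift2\<close>.\<close>

lemma lift2_preimage:
  assumes h: "frame_hom h" and w: "continuous_on UNIV w" and v: "continuous_on UNIV v"
    and c: "continuous_on UNIV (\<lambda>(x, y). c x y)"
  shows "lift2 c (h \<circ> preimage w) (h \<circ> preimage v) = h \<circ> preimage (\<lambda>x. c (w x) (v x))"
proof
  fix V
  have wv: "continuous_on UNIV (\<lambda>x. c (w x) (v x))"
    using continuous_on_compose2[OF c continuous_on_Pair[OF w v]] by simp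
  define B where "B = {inf (preimage w U\<^sub>1) (preimage v U\<^sub>2) | U\<^sub>1 U\<^sub>2.
    (\<lambda>(x, y). c x y) ` (points_of U\<^sub>1 \<times> points_of U\<^sub>2) \<subseteq> points_of V}"
  have "preimage (\<lambda>x. c (w x) (v x)) V = Sup B"
  proof (rule opens_eqI, rule set_eqI)
    fix x
    show "x \<in> points_of (preimage (\<lambda>x. c (w x) (v x)) V) \<longleftrightarrow> x \<in> points_of (Sup B)"
    proof
      assume "x \<in> points_of (preimage (\<lambda>x. c (w x) (v x)) V)"
      then have "(w x, v x) \<in> (\<lambda>(x, y). c x y) -` points_of V"
        by (simp add: wv)
      moreover have "open ((\<lambda>(x, y). c x y) -` points_of V)"
        using c by (simp add: open_vimage)
      ultimately obtain S T where ST: "open S" "open T" "(w x, v x) \<in> S \<times> T"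
          "S \<times> T \<subseteq> (\<lambda>(x, y). c x y) -` points_of V"
        by (elim open_prod_elim)
      then have "inf (preimage w (Opens S)) (preimage v (Opens T)) \<in> B"
        unfolding B_def by (intro CollectI exI[of _ "Opens S"] exI[of _ "Opens T"]) auto
      moreover have "x \<in> points_of (inf (preimage w (Opens S)) (preimage v (Opens T)))"
        using ST by (simp add: w v)
      ultimately show "x \<in> points_of (Sup B)"
        unfolding points_of_simps(5) by blast
    next
      assume "x \<in> points_of (Sup B)"
      then show "x \<in> points_of (preimage (\<lambda>x. c (w x) (v x)) V)"
        by (auto simp: B_def w v wv image_subset_iff)
    qed
  qed
  moreover have "h ` B = {inf (h (preimage w U\<^sub>1)) (h (preimage v U\<^sub>2)) | U\<^sub>1 U\<^sub>2.
    (\<lambda>(x, y). c x y) ` (points_of U\<^sub>1 \<times> points_of U\<^sub>2) \<subseteq> points_of V}"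
    unfolding B_def image_def mem_Collect_eq frame_homD(2)[OF h, symmetric] by blast
  ultimately show "lift2 c (h \<circ> preimage w) (h \<circ> preimage v) V = (h \<circ> preimage (\<lambda>x. c (w x) (v x))) V"
    by (simp add: lift2_def frame_homD(3)[OF h])
qed

section \<open>Extension of two homomorphisms to the plane\<close>

text \<open>The copairing of \<open>f\<^sub>1\<close> and \<open>f\<^sub>2\<close>, with the open
  sets of the plane as the coproduct of two copies of the open sets of the line.\<close>

definition joint :: "(real opens \<Rightarrow> 'l::frame) \<Rightarrow> (real opens \<Rightarrow> 'l) \<Rightarrow> (real \<times> real) opens \<Rightarrow> 'l" where
  "joint f\<^sub>1 f\<^sub>2 W = Sup {inf (f\<^sub>1 U\<^sub>1) (f\<^sub>2 U\<^sub>2) | U\<^sub>1 U\<^sub>2. points_of U\<^sub>1 \<times> points_of U\<^sub>2 \<subseteq> points_of W}"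

lemma joint_upper:
  "points_of U\<^sub>1 \<times> points_of U\<^sub>2 \<subseteq> points_of W \<Longrightarrow> inf (f\<^sub>1 U\<^sub>1) (f\<^sub>2 U\<^sub>2) \<le> joint f\<^sub>1 f\<^sub>2 W"
  unfolding joint_def by (rule Sup_upper) auto

lemma joint_mono: "W \<le> W' \<Longrightarrow> joint f\<^sub>1 f\<^sub>2 W \<le> joint f\<^sub>1 f\<^sub>2 W'"
  unfolding joint_def less_eq_opens_def by (rule Sup_subset_mono) blast

text \<open>These balls have compact closure inside \<open>U\<close>, as the Lebesgue number
  argument requires.\<close>

lemma frame_hom_le_cballs:
  fixes U :: "real opens"
  assumes "frame_hom f"
  shows "f U \<le> Sup (f ` {Opens (ball x e) | x e. cball x e \<subseteq> points_of U})"
proof (rule frame_hom_le_Sup[OF assms], unfold less_eq_opens_def, rule subsetI)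
  fix x assume x: "x \<in> points_of U"
  then obtain e where e: "e > 0" "cball x e \<subseteq> points_of U"
    using open_contains_cball[of "points_of U"] by auto
  then show "x \<in> points_of (Sup {Opens (ball x e) |x e. cball x e \<subseteq> points_of U})"
    by (auto intro!: exI[of _ "Opens (ball x e)"])
qed

text \<open>Centres are taken in \<open>U\<close> because a Lebesgue number speaks only about points
  of the covered compact set.\<close>

lemma frame_hom_le_small_balls:
  assumes "frame_hom f" and "d > (0::real)"
  shows "f U \<le> Sup (f ` {inf U (Opens (ball u d)) | u. u \<in> points_of U})"
  by (rule frame_hom_le_Sup[OF assms(1)]) (use assms(2) in \<open>force simp: less_eq_opens_def\<close>)

text \<open>
  The localic product of two copies of the real line is the frame of open sets of the plane: a
  compact rectangle covered by open sets has a Lebesgue number, so it can be cut into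
  rectangles each of which lies in one of them.
\<close>
lemma joint_Sup_le:
  assumes f\<^sub>1: "frame_hom f\<^sub>1" and f\<^sub>2: "frame_hom f\<^sub>2"
  shows "joint f\<^sub>1 f\<^sub>2 (Sup A) \<le> (SUP W\<in>A. joint f\<^sub>1 f\<^sub>2 W)" (is "_ \<le> ?R")
proof -
  have box: "inf (f\<^sub>1 (Opens (ball x e))) (f\<^sub>2 (Opens (ball y e'))) \<le> ?R"
    if K: "cball x e \<times> cball y e' \<subseteq> points_of (Sup A)" for x e y e'
  proof -
    have "compact (cball x e \<times> cball y e')"
      by (intro compact_Times compact_cball)
    then obtain d where d: "d > 0"
      "\<And>z. z \<in> cball x e \<times> cball y e' \<Longrightarrow> \<exists>G\<in>points_of ` A. ball z d \<subseteq> G"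
      using K by (auto elim!: Heine_Borel_lemma[of _ "points_of ` A"])
    \<comment> \<open>Radius \<open>d/2\<close> in each coordinate keeps the product of two balls
      inside a ball of radius \<open>d\<close> in the plane.\<close>
    let ?B = "\<lambda>x e. {inf (Opens (ball x e)) (Opens (ball u (d/2))) |u. u \<in> points_of (Opens (ball x e))}"
    have "inf (f\<^sub>1 (Opens (ball x e))) (f\<^sub>2 (Opens (ball y e')))
        \<le> inf (Sup (f\<^sub>1 ` ?B x e)) (Sup (f\<^sub>2 ` ?B y e'))"
      using d(1) by (intro inf_mono frame_hom_le_small_balls f\<^sub>1 f\<^sub>2) auto
    also have "\<dots> \<le> ?R"
    proof (rule inf_Sup_Sup_le)
      fix a b assume "a \<in> f\<^sub>1 ` ?B x e" "b \<in> f\<^sub>2 ` ?B y e'"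
      then obtain u v where u: "u \<in> ball x e" "a = f\<^sub>1 (inf (Opens (ball x e)) (Opens (ball u (d/2))))"
        and v: "v \<in> ball y e'" "b = f\<^sub>2 (inf (Opens (ball y e')) (Opens (ball v (d/2))))"
        by auto
      then obtain W where W: "W \<in> A" "ball (u, v) d \<subseteq> points_of W"
        using d(2)[of "(u, v)"] by auto
      have "ball u (d/2) \<times> ball v (d/2) \<subseteq> ball (u, v) d"
      proof clarify
        fix s t assume "s \<in> ball u (d/2)" "t \<in> ball v (d/2)"
        moreover have "dist (u, v) (s, t) \<le> dist u s + dist v t"
          by (simp add: dist_Pair_Pair sqrt_sum_squares_le_sum)
        ultimately show "(s, t) \<in> ball (u, v) d"
          by simp
      qed
      then have "inf a b \<le> joint f\<^sub>1 f\<^sub>2 W"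
        unfolding u v using W(2) by (intro joint_upper) auto
      also have "\<dots> \<le> ?R"
        using W(1) by (rule SUP_upper)
      finally show "inf a b \<le> ?R" .
    qed
    finally show ?thesis .
  qed
  have "inf (f\<^sub>1 U\<^sub>1) (f\<^sub>2 U\<^sub>2) \<le> ?R" if U: "points_of U\<^sub>1 \<times> points_of U\<^sub>2 \<subseteq> points_of (Sup A)" for U\<^sub>1 U\<^sub>2
  proof -
    have "inf (f\<^sub>1 U\<^sub>1) (f\<^sub>2 U\<^sub>2) \<le>
        inf (Sup (f\<^sub>1 ` {Opens (ball x e) | x e. cball x e \<subseteq> points_of U\<^sub>1}))
            (Sup (f\<^sub>2 ` {Opens (ball x e) | x e. cball x e \<subseteq> points_of U\<^sub>2}))"
      by (intro inf_mono frame_hom_le_cballs f\<^sub>1 f\<^sub>2)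
    also have "\<dots> \<le> ?R"
    proof (rule inf_Sup_Sup_le)
      fix a b assume "a \<in> f\<^sub>1 ` {Opens (ball x e) | x e. cball x e \<subseteq> points_of U\<^sub>1}"
        "b \<in> f\<^sub>2 ` {Opens (ball x e) | x e. cball x e \<subseteq> points_of U\<^sub>2}"
      then obtain x e y e' where "a = f\<^sub>1 (Opens (ball x e))" "cball x e \<subseteq> points_of U\<^sub>1"
        "b = f\<^sub>2 (Opens (ball y e'))" "cball y e' \<subseteq> points_of U\<^sub>2"
        by auto
      then show "inf a b \<le> ?R"
        using box[of x e y e'] U by blast
    qed
    finally show ?thesis .
  qed
  then show ?thesis
    unfolding joint_def[of _ _ "Sup A"] by (intro Sup_least) blast
qed

text \<open>Rectangles are closed under intersection, which gives meets; joins are the compactness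
  argument of \<open>joint_Sup_le\<close>.\<close>

lemma frame_hom_joint:
  assumes f\<^sub>1: "frame_hom f\<^sub>1" and f\<^sub>2: "frame_hom f\<^sub>2"
  shows "frame_hom (joint f\<^sub>1 f\<^sub>2)"
  unfolding frame_hom_def
proof (intro conjI allI)
  show "joint f\<^sub>1 f\<^sub>2 top = top"
    using joint_upper[of top top top f\<^sub>1 f\<^sub>2] by (simp add: frame_homD(1) f\<^sub>1 f\<^sub>2 top_le)
  fix W W'
  show "joint f\<^sub>1 f\<^sub>2 (inf W W') = inf (joint f\<^sub>1 f\<^sub>2 W) (joint f\<^sub>1 f\<^sub>2 W')"
  proof (rule antisym)
    show "inf (joint f\<^sub>1 f\<^sub>2 W) (joint f\<^sub>1 f\<^sub>2 W') \<le> joint f\<^sub>1 f\<^sub>2 (inf W W')"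
      unfolding joint_def[of _ _ W] joint_def[of _ _ W']
    proof (rule inf_Sup_Sup_le, clarify)
      fix U\<^sub>1 U\<^sub>2 U\<^sub>1' U\<^sub>2'
      assume U: "points_of U\<^sub>1 \<times> points_of U\<^sub>2 \<subseteq> points_of W" "points_of U\<^sub>1' \<times> points_of U\<^sub>2' \<subseteq> points_of W'"
      have "inf (inf (f\<^sub>1 U\<^sub>1) (f\<^sub>2 U\<^sub>2)) (inf (f\<^sub>1 U\<^sub>1') (f\<^sub>2 U\<^sub>2')) = inf (f\<^sub>1 (inf U\<^sub>1 U\<^sub>1')) (f\<^sub>2 (inf U\<^sub>2 U\<^sub>2'))"
        by (simp add: frame_homD(2) f\<^sub>1 f\<^sub>2 inf_left_commute inf_assoc)
      also have "\<dots> \<le> joint f\<^sub>1 f\<^sub>2 (inf W W')"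
        using U by (intro joint_upper) auto
      finally show "inf (inf (f\<^sub>1 U\<^sub>1) (f\<^sub>2 U\<^sub>2)) (inf (f\<^sub>1 U\<^sub>1') (f\<^sub>2 U\<^sub>2')) \<le> joint f\<^sub>1 f\<^sub>2 (inf W W')" .
    qed
  qed (simp add: joint_mono)
next
  fix A
  show "joint f\<^sub>1 f\<^sub>2 (Sup A) = Sup (joint f\<^sub>1 f\<^sub>2 ` A)"
    by (intro antisym joint_Sup_le f\<^sub>1 f\<^sub>2 SUP_least joint_mono Sup_upper)
qed

text \<open>A rectangle with nonempty second side lies in the strip over \<open>V\<close> only if
  its first side lies in \<open>V\<close>; with empty second side it contributes bottom.\<close>

lemma joint_preimage_fst:
  assumes f\<^sub>1: "frame_hom f\<^sub>1" and f\<^sub>2: "frame_hom f\<^sub>2"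
  shows "joint f\<^sub>1 f\<^sub>2 \<circ> preimage fst = f\<^sub>1"
proof
  fix V
  have c: "continuous_on UNIV (fst :: real \<times> real \<Rightarrow> real)"
    by (intro continuous_intros)
  have "inf (f\<^sub>1 U\<^sub>1) (f\<^sub>2 U\<^sub>2) \<le> f\<^sub>1 V" if "points_of U\<^sub>1 \<times> points_of U\<^sub>2 \<subseteq> fst -` points_of V" for U\<^sub>1 U\<^sub>2
  proof (cases "U\<^sub>2 = bot")
    case False
    then have "points_of U\<^sub>2 \<noteq> {}"
      by (metis opens_eqI points_of_simps(3))
    then have "U\<^sub>1 \<le> V"
      using that by (auto simp: less_eq_opens_def)
    then show ?thesis
      by (simp add: frame_hom_mono[OF f\<^sub>1] le_infI1)
  qed (simp add: frame_hom_bot f\<^sub>2)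
  then have "joint f\<^sub>1 f\<^sub>2 (preimage fst V) \<le> f\<^sub>1 V"
    unfolding joint_def by (intro Sup_least) (auto simp: c)
  moreover have "f\<^sub>1 V \<le> joint f\<^sub>1 f\<^sub>2 (preimage fst V)"
    using joint_upper[of V top "preimage fst V" f\<^sub>1 f\<^sub>2] by (simp add: c frame_homD(1)[OF f\<^sub>2] subset_iff)
  ultimately show "(joint f\<^sub>1 f\<^sub>2 \<circ> preimage fst) V = f\<^sub>1 V"
    by simp
qed

lemma joint_preimage_snd:
  assumes f\<^sub>1: "frame_hom f\<^sub>1" and f\<^sub>2: "frame_hom f\<^sub>2"
  shows "joint f\<^sub>1 f\<^sub>2 \<circ> preimage snd = f\<^sub>2"
proof
  fix V
  have c: "continuous_on UNIV (snd :: real \<times> real \<Rightarrow> real)"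
    by (intro continuous_intros)
  have "inf (f\<^sub>1 U\<^sub>1) (f\<^sub>2 U\<^sub>2) \<le> f\<^sub>2 V" if "points_of U\<^sub>1 \<times> points_of U\<^sub>2 \<subseteq> snd -` points_of V" for U\<^sub>1 U\<^sub>2
  proof (cases "U\<^sub>1 = bot")
    case False
    then have "points_of U\<^sub>1 \<noteq> {}"
      by (metis opens_eqI points_of_simps(3))
    then have "U\<^sub>2 \<le> V"
      using that by (auto simp: less_eq_opens_def)
    then show ?thesis
      by (simp add: frame_hom_mono[OF f\<^sub>2] le_infI2)
  qed (simp add: frame_hom_bot f\<^sub>1)
  then have "joint f\<^sub>1 f\<^sub>2 (preimage snd V) \<le> f\<^sub>2 V"
    unfolding joint_def by (intro Sup_least) (auto simp: c)
  moreover have "f\<^sub>2 V \<le> joint f\<^sub>1 f\<^sub>2 (preimage snd V)"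
    using joint_upper[of top V "preimage snd V" f\<^sub>1 f\<^sub>2] by (simp add: c frame_homD(1)[OF f\<^sub>1] subset_iff)
  ultimately show "(joint f\<^sub>1 f\<^sub>2 \<circ> preimage snd) V = f\<^sub>2 V"
    by simp
qed

section \<open>Functions with equal pullbacks\<close>

text \<open>
  Where two continuous functions differ, some rational strictly separates them, and \<open>h\<close>
  sends the two disjoint half-lines to disjoint elements.
\<close>
lemma pullback_differ_null:
  assumes h: "frame_hom h" and w: "continuous_on UNIV w" and v: "continuous_on UNIV v"
    and eq: "h \<circ> preimage w = h \<circ> preimage v"
  shows "h (Opens {x. w x \<noteq> v x}) = bot"
proof -
  let ?P = "\<lambda>w v r. inf (preimage w (Opens {..<r})) (preimage v (Opens {r<..}))"
  \<comment> \<open>\<open>w\<close> and \<open>v\<close> are bound anew, so that their roles can be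
    exchanged below. The equality moves the second half-line from \<open>v\<close> to
    \<open>w\<close>, where the two preimages are disjoint.\<close>
  have null: "h (?P w v r) = bot"
    if w: "continuous_on UNIV w" and eq: "h \<circ> preimage w = h \<circ> preimage v" for w v :: "'a \<Rightarrow> real" and r
  proof -
    have "h (?P w v r) = inf (h (preimage w (Opens {..<r}))) (h (preimage w (Opens {r<..})))"
      using fun_cong[OF eq, of "Opens {r<..}"] by (simp add: frame_homD(2)[OF h])
    also have "\<dots> = h bot"
      unfolding frame_homD(2)[OF h, symmetric]
      by (rule arg_cong[where f = h], rule opens_eqI) (auto simp: w)
    finally show ?thesis
      by (simp add: frame_hom_bot[OF h])
  qed
  have op: "open {x. w x \<noteq> v x}"
    using w v by (simp add: open_Collect_neq)
  have "h (Opens {x. w x \<noteq> v x}) \<le> Sup (h ` (range (?P w v) \<union> range (?P v w)))"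
  proof (rule frame_hom_le_Sup[OF h], unfold less_eq_opens_def, rule subsetI)
    fix x assume "x \<in> points_of (Opens {x. w x \<noteq> v x})"
    then consider "w x < v x" | "v x < w x"
      using op by (force simp: neq_iff)
    then show "x \<in> points_of (Sup (range (?P w v) \<union> range (?P v w)))"
    proof cases
      case 1
      then show ?thesis
        using dense[OF 1] by (auto simp: w v)
    next
      case 2
      then show ?thesis
        using dense[OF 2] by (auto simp: w v)
    qed
  qed
  also have "\<dots> \<le> bot"
    by (rule Sup_least) (use null[OF w eq] null[OF v eq[symmetric]] in auto)
  finally show ?thesis
    by (simp add: bot_unique)
qed

lemma frame_hom_le_mod_null:
  assumes "frame_hom h" "h D = bot" "U \<le> sup V D"
  shows "h U \<le> h V"
  using frame_hom_mono[OF assms(1,3)] by (simp add: frame_hom_sup assms)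

section \<open>Computing in a Madden representation\<close>

text \<open>Exceptional sets outside which pointwise arguments take place; openness is demanded
  because \<open>Opens\<close> is unspecified elsewhere.\<close>

definition null :: "('x::topological_space opens \<Rightarrow> 'l::frame) \<Rightarrow> 'x set \<Rightarrow> bool" where
  "null h D \<longleftrightarrow> open D \<and> h (Opens D) = bot"

lemma null_Un:
  assumes h: "frame_hom h" and D: "null h D" "null h E"
  shows "null h (D \<union> E)"
proof -
  have "Opens (D \<union> E) = sup (Opens D) (Opens E)"
    using D by (intro opens_eqI) (simp add: null_def open_Un)
  then show ?thesis
    using D by (simp add: null_def open_Un frame_hom_sup[OF h])
qed

text \<open>The bridge from points to the target frame: joining \<open>D\<close> to an open set does
  not change its image, so implications are checked off \<open>D\<close>.\<close>

lemma pullback_le_mod_null: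
  assumes h: "frame_hom h" and w: "continuous_on UNIV w" and v: "continuous_on UNIV v" and D: "null h D"
    and le: "\<And>x. x \<notin> D \<Longrightarrow> w x \<in> points_of U \<Longrightarrow> v x \<in> points_of V"
  shows "h (preimage w U) \<le> h (preimage v V)"
  by (rule frame_hom_le_mod_null[OF h, of "Opens D"])
    (use D le in \<open>auto simp: null_def less_eq_opens_def w v\<close>)

context madden_representation
begin

text \<open>\<open>w\<close> is not determined by \<open>g\<close>; two choices differ on a null
  set, and this turns equations in the trunc into constraints on points.\<close>

definition represents :: "('x::topological_space opens \<Rightarrow> 'l) \<Rightarrow> ('x \<Rightarrow> real) \<Rightarrow> 'g \<Rightarrow> bool" where
  "represents h w g \<longleftrightarrow> frame_hom h \<and> continuous_on UNIV w \<and> \<phi> g = h \<circ> preimage w"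

lemma frame_hom_rep: "frame_hom (\<phi> g)"
  using rep_R0[of g] by (simp add: R0_def pointed_frame_hom_def)

lemma represents_self: "represents (\<phi> g) (\<lambda>x. x) g"
  by (auto simp: represents_def frame_hom_rep preimage_def points_of_inverse)

lemma represents_fst: "represents (joint (\<phi> g) (\<phi> k)) fst g"
  and represents_snd: "represents (joint (\<phi> g) (\<phi> k)) snd k"
  by (simp_all add: represents_def frame_hom_joint frame_hom_rep joint_preimage_fst joint_preimage_snd
      continuous_on_fst continuous_on_snd)

text \<open>Change of variable: the first premise makes \<open>g\<close> the function
  \<open>c\<close> of \<open>k\<close>.\<close>

lemma represents_compose:
  assumes "represents (\<phi> k) c g" "represents h w k"
  shows "represents h (\<lambda>x. c (w x)) g"
proof -
  have c: "continuous_on UNIV c" and w: "continuous_on UNIV w"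
    using assms by (auto simp: represents_def)
  have cw: "continuous_on UNIV (\<lambda>x. c (w x))"
    using continuous_on_compose2[OF c w] by simp
  have "preimage w \<circ> preimage c = preimage (\<lambda>x. c (w x))"
    by (rule ext, rule opens_eqI) (auto simp: c w cw)
  then show ?thesis
    using assms cw by (simp add: represents_def comp_assoc)
qed

lemma represents_add:
  assumes "represents h w g" "represents h v k"
  shows "represents h (\<lambda>x. w x + v x) (g + k)"
proof -
  have "continuous_on UNIV (\<lambda>(x, y). x + y :: real)"
    by (auto simp: case_prod_beta intro!: continuous_intros)
  then show ?thesis
    using assms by (auto simp: represents_def rep_add lift2_preimage intro!: continuous_intros)
qed

lemma represents_scaleR:
  assumes "represents h w g"
  shows "represents h (\<lambda>x. c * w x) (c *\<^sub>R g)"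
proof -
  have "continuous_on UNIV ((*) c)"
    by (intro continuous_intros)
  then show ?thesis
    using assms by (auto simp: represents_def rep_scaleR lift1_preimage intro!: continuous_intros)
qed

lemma represents_sup:
  assumes "represents h w g" "represents h v k"
  shows "represents h (\<lambda>x. max (w x) (v x)) (sup g k)"
proof -
  have "continuous_on UNIV (\<lambda>(x, y). max x y :: real)"
    by (auto simp: case_prod_beta intro!: continuous_intros)
  then show ?thesis
    using assms by (auto simp: represents_def rep_sup lift2_preimage intro!: continuous_intros)
qed

lemma represents_truncate:
  assumes "represents h w g" "0 \<le> g"
  shows "represents h (\<lambda>x. min (w x) 1) (truncate g)"
proof -
  have "continuous_on UNIV (\<lambda>x. min x 1 :: real)"
    by (intro continuous_intros)
  then show ?thesis
    using assms by (auto simp: represents_def rep_truncate lift1_preimage intro!: continuous_intros)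
qed

lemma represents_0:
  assumes "represents h w g"
  shows "represents h (\<lambda>_. 0) 0"
  using represents_scaleR[OF assms, of 0] by simp

lemma represents_diff:
  assumes "represents h w g" "represents h v k"
  shows "represents h (\<lambda>x. w x - v x) (g - k)"
  using represents_add[OF assms(1) represents_scaleR[OF assms(2), of "-1"]] by simp

text \<open>Scaling by \<open>n\<close> turns the cut at 1 into a cut at \<open>n\<close>, so the
  formal infimum is the pointwise one.\<close>

lemma represents_inf_nat:
  assumes g: "represents h w g" "0 \<le> g" and n: "1 \<le> n"
  shows "represents h (\<lambda>x. min (w x) (real n)) (inf_nat g n)"
proof -
  have "represents h (\<lambda>x. real n * min (inverse (real n) * w x) 1) (inf_nat g n)"
    unfolding inf_nat_def
    by (intro represents_scaleR represents_truncate g scaleR_nonneg_nonneg) simp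
  moreover have "real n * min (inverse (real n) * w x) 1 = min (w x) (real n)" for x
    using n by (simp add: min_def field_simps)
  ultimately show ?thesis
    by simp
qed

lemma represents_differ_null:
  assumes "represents h w g" "represents h v g"
  shows "null h {x. w x \<noteq> v x}"
  using assms pullback_differ_null[of h w v]
  by (auto simp: represents_def null_def intro!: open_Collect_neq)

text \<open>Positivity is the equation \<open>sup g 0 = g\<close>, so the set where \<open>w\<close>
  is negative is null.\<close>

lemma represents_negative_null:
  assumes "represents h w g" "0 \<le> g"
  shows "null h {x. w x \<noteq> max (w x) 0}"
  using represents_differ_null[OF assms(1)] represents_sup[OF assms(1) represents_0[OF assms(1)]]
  by (simp add: sup.absorb1 assms(2))

lemma represents_le:
  assumes "represents h w g" "represents h v k" "null h D"
    and "\<And>x. x \<notin> D \<Longrightarrow> w x \<in> points_of U \<Longrightarrow> v x \<in> points_of V"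
  shows "\<phi> g U \<le> \<phi> k V"
  using assms pullback_le_mod_null[of h w v D U V] by (simp add: represents_def)

text \<open>Converse to \<open>represents_differ_null\<close>: both inequalities hold on every open
  set, and \<open>\<phi>\<close> is injective.\<close>

lemma represents_eqI:
  assumes "represents h w g" "represents h v k" "null h D" "\<And>x. x \<notin> D \<Longrightarrow> w x = v x"
  shows "g = k"
  by (rule injD[OF inj_rep], rule ext, rule antisym)
    (rule represents_le[OF assms(1,2,3)] represents_le[OF assms(2,1,3)]; simp add: assms(4))+

lemma represents_nonnegI:
  assumes "represents h w g" "null h D" "\<And>x. x \<notin> D \<Longrightarrow> 0 \<le> w x"
  shows "0 \<le> g"
proof -
  have "sup g 0 = g"
    by (rule represents_eqI[OF represents_sup[OF assms(1) represents_0[OF assms(1)]] assms(1,2)])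
      (simp add: assms(3))
  then show ?thesis
    by (metis sup.cobounded2)
qed

text \<open>The way back to one variable: what is a function of \<open>k\<close> on a larger space,
  up to a null set, is the same function of \<open>k\<close> on the line.\<close>

lemma represents_self_by:
  assumes "represents h w k" "represents h v g" "null h D" "\<And>x. x \<notin> D \<Longrightarrow> v x = c (w x)"
    and c: "continuous_on UNIV c"
  shows "represents (\<phi> k) c g"
proof -
  have h: "frame_hom h" and w: "continuous_on UNIV w" and v: "continuous_on UNIV v"
    and k: "\<phi> k = h \<circ> preimage w" and g: "\<phi> g = h \<circ> preimage v"
    using assms by (auto simp: represents_def)
  have cw: "continuous_on UNIV (\<lambda>x. c (w x))"
    using continuous_on_compose2[OF c w] by simp
  have "h (preimage v V) = h (preimage w (preimage c V))" for V
  proof -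
    have "preimage w (preimage c V) = preimage (\<lambda>x. c (w x)) V"
      by (rule opens_eqI) (auto simp: c w cw)
    then show ?thesis
      by (auto intro!: antisym pullback_le_mod_null[OF h _ _ assms(3)] simp: v cw assms(4))
  qed
  then have "\<phi> g = \<phi> k \<circ> preimage c"
    by (auto simp: k g)
  then show ?thesis
    by (simp add: represents_def frame_hom_rep c)
qed

section \<open>Zero, truncated elements and decrease to zero\<close>

text \<open>The constant function 0 has only the whole line and the empty set as preimages.\<close>

lemma rep_0: "\<phi> 0 U = (if 0 \<in> points_of U then top else bot)"
proof -
  have "\<phi> 0 U = \<phi> 0 (preimage (\<lambda>_::real. 0) U)"
    using represents_0[OF represents_self[of 0]] by (metis represents_def comp_apply)
  moreover have "preimage (\<lambda>_::real. 0) U = (if 0 \<in> points_of U then top else bot)"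
    by (rule opens_eqI) auto
  ultimately show ?thesis
    using frame_hom_bot[OF frame_hom_rep[of 0]] frame_homD(1)[OF frame_hom_rep[of 0]] by simp
qed

lemma truncate_truncated:
  fixes f :: 'g
  assumes "f \<in> truncated"
  shows "0 \<le> f" "truncate f = f"
proof -
  obtain g where g: "0 \<le> g" "f = truncate g"
    using assms by (auto simp: truncated_def)
  then show f: "0 \<le> f"
    by (simp add: truncate_nonneg)
  have *: "represents (\<phi> g) (\<lambda>x. min x 1) f"
    using represents_truncate[OF represents_self g(1)] g(2) by simp
  show "truncate f = f"
    \<comment> \<open>A function compared with itself gives the empty set as null set.\<close>
    by (rule represents_eqI[OF represents_truncate[OF * f] * represents_differ_null[OF * *]]) simp
qed

text \<open>\<open>f'\<close> is its own truncation and lies below \<open>f + f'\<close>, so the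
  axiom \<open>inf_truncate_le\<close> puts it below \<open>truncate (f + f')\<close>.\<close>

lemma good_step_decreasing:
  fixes f f' :: 'g
  assumes "f = truncate (f + f')" "0 \<le> f" "f' \<in> truncated"
  shows "f' \<le> f"
proof -
  have "f' = inf (f + f') (truncate f')"
    using assms truncate_truncated[of f'] by (simp add: inf.absorb2)
  also have "\<dots> \<le> truncate (f + f')"
    using assms truncate_truncated[of f'] by (intro inf_truncate_le) auto
  finally show ?thesis
    using assms(1) by simp
qed

text \<open>For \<open>r \<le> 0\<close> both sides are bottom by positivity, which leaves positive
  thresholds.\<close>

lemma decreases_to_0I:
  assumes dec: "\<And>n. 1 \<le> n \<Longrightarrow> d (n + 1) \<le> d n" and nonneg: "\<And>n. 1 \<le> n \<Longrightarrow> 0 \<le> d n"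
    and top: "\<And>r. 0 < r \<Longrightarrow> (SUP n\<in>{1..}. \<phi> (d n) (Opens {..<r})) = top"
  shows "decreases_to \<phi> d 0"
  unfolding decreases_to_def
proof (intro conjI allI impI)
  fix r :: real
  show "(SUP n\<in>{1..}. \<phi> (d n) (Opens {..<r})) = \<phi> 0 (Opens {..<r})"
  proof (cases "0 < r")
    case False
    have "\<phi> (d n) (Opens {..<r}) \<le> bot" if "1 \<le> n" for n
    proof -
      have "\<phi> (d n) (Opens {..<r}) \<le> \<phi> (d n) bot"
        by (rule represents_le[OF represents_self represents_self
              represents_negative_null[OF represents_self nonneg[OF that]]])
          (use False in auto)
      then show ?thesis
        by (simp add: frame_hom_bot frame_hom_rep)
    qed
    then show ?thesis
      using False by (auto simp: rep_0 bot_unique[symmetric] intro!: SUP_least)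
  next
    case True
    then show ?thesis
      using top[OF True] by (simp add: rep_0)
  qed
qed (rule dec)

section \<open>From truncation sequences to good sequences\<close>

text \<open>In the variable \<open>x\<close> given by \<open>g (n + 1)\<close>, nonnegative off a
  null set, \<open>g n\<close> and \<open>g (n - 1)\<close> are the cuts of \<open>x\<close> at
  \<open>n\<close> and \<open>n - 1\<close>. Hence \<open>d n + d (n + 1)\<close> is the part of
  \<open>x\<close> above \<open>n - 1\<close>, and its truncation is the part between
  \<open>n - 1\<close> and \<open>n\<close>, which is \<open>d n\<close>.\<close>

lemma good_differences:
  assumes "truncation_sequence \<phi> g"
  shows "good_sequence \<phi> (differences g)"
proof -
  define d where "d = differences g"
  have g_nonneg: "0 \<le> g n" if "1 \<le> n" for n
    using assms that unfolding truncation_sequence_def PiE_iff by blast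
  have g_eq: "g n = inf_nat (g (n + 1)) n" if "1 \<le> n" for n
    using assms that unfolding truncation_sequence_def PiE_iff by blast
  have d_eq: "d n = g n - (if n = 1 then 0 else g (n - 1))" if "1 \<le> n" for n
    using that by (simp add: d_def differences_def)
  have g_rep: "represents (\<phi> (g (n + 1))) (\<lambda>x. min x (real n)) (g n)" if "1 \<le> n" for n
    using represents_inf_nat[OF represents_self g_nonneg that] g_eq[OF that] by simp
  have d_Suc_rep: "represents (\<phi> (g (n + 1))) (\<lambda>x. x - min x (real n)) (d (n + 1))" if "1 \<le> n" for n
    using represents_diff[OF represents_self g_rep[OF that]] that by (simp add: d_eq)
  have step: "0 \<le> d n + d (n + 1)" "d n = truncate (d n + d (n + 1))" if n: "1 \<le> n" for n
  proof -
    let ?h = "\<phi> (g (n + 1))"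
    have D: "null ?h {x. x \<noteq> max x 0}"
      by (rule represents_negative_null[OF represents_self g_nonneg]) simp
    \<comment> \<open>For \<open>n = 1\<close> the term is 0, which agrees with the cut at 0 for
      nonnegative \<open>x\<close> only.\<close>
    have "\<exists>v. represents ?h v (if n = 1 then 0 else g (n - 1)) \<and> (\<forall>x\<ge>0. v x = min x (real n - 1))"
    proof (cases "n = 1")
      case True
      then show ?thesis
        using represents_0[OF represents_self] by auto
    next
      case False
      then have "g (n - 1) = inf_nat (g n) (n - 1)"
        using n g_eq[of "n - 1"] by simp
      then have "represents ?h (\<lambda>x. min (min x (real n)) (real (n - 1))) (g (n - 1))"
        using represents_inf_nat[OF g_rep[OF n] g_nonneg[OF n], of "n - 1"] False n by simp
      then show ?thesis
        using False n by (intro exI[of _ "\<lambda>x. min (min x (real n)) (real (n - 1))"]) auto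
    qed
    then obtain v where v: "represents ?h v (if n = 1 then 0 else g (n - 1))"
        "\<And>x. 0 \<le> x \<Longrightarrow> v x = min x (real n - 1)"
      by auto
    have d: "represents ?h (\<lambda>x. min x (real n) - v x) (d n)"
      unfolding d_eq[OF n] by (rule represents_diff[OF g_rep[OF n] v(1)])
    note sum = represents_add[OF d d_Suc_rep[OF n]]
    show nonneg: "0 \<le> d n + d (n + 1)"
      by (rule represents_nonnegI[OF sum D]) (use n v(2) in auto)
    show "d n = truncate (d n + d (n + 1))"
      by (rule represents_eqI[OF d represents_truncate[OF sum nonneg] D])
        (use n v(2) in \<open>auto simp: min_def max_def split: if_splits\<close>)
  qed
  have truncated: "d n \<in> truncated" if "1 \<le> n" for n
    unfolding truncated_def using step[OF that] by blast
  have "decreases_to \<phi> d 0"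
  proof (rule decreases_to_0I)
    show "d (n + 1) \<le> d n" if "1 \<le> n" for n
      by (rule good_step_decreasing[OF step(2) truncate_truncated(1)[OF truncated] truncated])
        (use that in auto)
    show "0 \<le> d n" if "1 \<le> n" for n
      by (rule truncate_truncated(1)[OF truncated[OF that]])
    fix r :: real assume r: "0 < r"
    \<comment> \<open>Where \<open>g n\<close> is below \<open>n\<close>, the variable
      \<open>g (n + 1)\<close> has not been cut, so \<open>d (n + 1)\<close> vanishes there; hence
      the shift of index.\<close>
    have "(SUP n\<in>{1..}. \<phi> (g n) (Opens {..<real n})) \<le> (SUP n\<in>{1..}. \<phi> (d n) (Opens {..<r}))"
    proof (rule SUP_mono)
      fix n :: nat assume n: "n \<in> {1..}"
      then have "\<phi> (g n) (Opens {..<real n}) \<le> \<phi> (d (n + 1)) (Opens {..<r})"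
        using r by (intro represents_le[OF g_rep d_Suc_rep represents_differ_null[OF represents_self represents_self]])
          (auto simp: min_def split: if_splits)
      then show "\<exists>k\<in>{1..}. \<phi> (g n) (Opens {..<real n}) \<le> \<phi> (d k) (Opens {..<r})"
        by (intro bexI[of _ "n + 1"]) auto
    qed
    moreover have "(SUP n\<in>{1..}. \<phi> (g n) (Opens {..<real n})) = top"
      using assms unfolding truncation_sequence_def by blast
    ultimately show "(SUP n\<in>{1..}. \<phi> (d n) (Opens {..<r})) = top"
      by (metis top_unique)
  qed
  moreover have "d \<in> {1..} \<rightarrow>\<^sub>E truncated"
    using truncated by (simp add: PiE_iff) (simp add: d_def differences_def)
  ultimately show ?thesis
    using step(2) unfolding good_sequence_def d_def[symmetric] by blast
qed

section \<open>From good sequences to truncation sequences\<close>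

text \<open>
  At a point, a good sequence reads \<open>1, \<dots>, 1, a, 0, 0, \<dots>\<close>: the term \<open>f\<^sub>m\<close> is the part of the
  partial sum above \<open>m - 1\<close>, and the partial sum is at most \<open>m\<close>.
\<close>
lemma partial_sum_step:
  assumes m: "1 \<le> (m::nat)" and nonneg: "0 \<le> s" "0 \<le> f'"
    and f: "f = truncate (f + f')" "0 \<le> f" and f': "truncate f' = f'"
    and excess: "represents (\<phi> s) (\<lambda>t. max (t - (real m - 1)) 0) f"
    and bound: "represents (\<phi> s) (\<lambda>t. min t (real m)) s"
  shows "represents (\<phi> (s + f')) (\<lambda>t. max (t - real m) 0) f'"
    and "represents (\<phi> (s + f')) (\<lambda>t. min t (real m + 1)) (s + f')"
    and "s = inf_nat (s + f') m"
proof -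
  define h where "h = joint (\<phi> s) (\<phi> f')"
  have h: "frame_hom h"
    by (simp add: h_def frame_hom_joint frame_hom_rep)
  have rs: "represents h fst s" and rf': "represents h snd f'"
    unfolding h_def by (rule represents_fst represents_snd)+
  \<comment> \<open>\<open>f\<close> is written in two ways, from \<open>s\<close> by
    \<open>excess\<close> and then as the truncation of \<open>f + f'\<close>; comparing them links
    the two coordinates.\<close>
  note rf = represents_compose[OF excess rs]
  have rf2: "represents h (\<lambda>x. min (max (fst x - (real m - 1)) 0 + snd x) 1) f"
    using represents_truncate[OF represents_add[OF rf rf']] f nonneg by simp
  have rf'2: "represents h (\<lambda>x. min (snd x) 1) f'"
    using represents_truncate[OF rf' nonneg(2)] f' by simp
  \<comment> \<open>Off \<open>D\<close> one has \<open>0 \<le> s \<le> m\<close>,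
    \<open>0 \<le> f' \<le> 1\<close>, and either \<open>f' = 0\<close> or \<open>s = m\<close>; all
    three conclusions follow by cases.\<close>
  define D where "D = {x. max (fst x - (real m - 1)) 0 \<noteq> min (max (fst x - (real m - 1)) 0 + snd x) 1}
     \<union> {x. snd x \<noteq> min (snd x) 1} \<union> {x. fst x \<noteq> min (fst x) (real m)}
     \<union> {x. fst x \<noteq> max (fst x) 0} \<union> {x. snd x \<noteq> max (snd x) 0}"
  have D: "null h D"
    unfolding D_def
    by (intro null_Un h represents_differ_null[OF rf rf2] represents_differ_null[OF rf' rf'2]
        represents_differ_null[OF rs represents_compose[OF bound rs]]
        represents_negative_null[OF rs nonneg(1)] represents_negative_null[OF rf' nonneg(2)])
  note sum = represents_add[OF rs rf']
  have cont: "continuous_on UNIV (\<lambda>t. max (t - real m) 0)" "continuous_on UNIV (\<lambda>t. min t (real m + 1))"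
    by (intro continuous_intros)+
  show "represents (\<phi> (s + f')) (\<lambda>t. max (t - real m) 0) f'"
    by (rule represents_self_by[OF sum rf' D _ cont(1)])
      (auto simp: D_def min_def max_def split: if_splits)
  show "represents (\<phi> (s + f')) (\<lambda>t. min t (real m + 1)) (s + f')"
    by (rule represents_self_by[OF sum sum D _ cont(2)])
      (auto simp: D_def min_def max_def split: if_splits)
  have "0 \<le> s + f'"
    using nonneg by simp
  then show "s = inf_nat (s + f') m"
    by (intro represents_eqI[OF rs represents_inf_nat[OF sum] D] m)
      (auto simp: D_def min_def max_def split: if_splits)
qed

text \<open>Induction along the partial sums: each step works in the plane of \<open>s m\<close> and
  \<open>f (m + 1)\<close> and ends on the line of \<open>s (m + 1)\<close>.\<close>

lemma truncation_partial_sums: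
  assumes "good_sequence \<phi> f"
  shows "truncation_sequence \<phi> (partial_sums f)"
proof -
  define s where "s m = (\<Sum>n=1..m. f n)" for m
  have s_eq: "partial_sums f m = s m" if "1 \<le> m" for m
    using that by (simp add: partial_sums_def s_def)
  have s_Suc: "s (m + 1) = s m + f (m + 1)" for m
    by (simp add: s_def)
  have f: "0 \<le> f n" "truncate (f n) = f n" if "1 \<le> n" for n
    using assms that truncate_truncated[of "f n"] unfolding good_sequence_def PiE_iff by auto
  have f_eq: "f n = truncate (f n + f (n + 1))" if "1 \<le> n" for n
    using assms that unfolding good_sequence_def by blast
  have s_nonneg: "0 \<le> s m" for m
    unfolding s_def by (rule sum_nonneg) (simp add: f)
  \<comment> \<open>The second half states as an equation that \<open>s m\<close> is at most
    \<open>m\<close>.\<close>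
  have inv: "represents (\<phi> (s m)) (\<lambda>t. max (t - (real m - 1)) 0) (f m)
      \<and> represents (\<phi> (s m)) (\<lambda>t. min t (real m)) (s m)" if "1 \<le> m" for m
    using that
  proof (induction m rule: nat_induct_at_least)
    \<comment> \<open>For \<open>m = 1\<close> the two halves are \<open>f 1 = sup (f 1) 0\<close>
      and \<open>f 1 = truncate (f 1)\<close>.\<close>
    case base
    have "s 1 = f 1" "sup (f 1) 0 = f 1"
      using f(1)[of 1] by (simp_all add: s_def sup.absorb1)
    then show ?case
      using represents_sup[OF represents_self[of "f 1"] represents_0[OF represents_self]]
        represents_truncate[OF represents_self f(1)[of 1]] f(2)[of 1] by simp
  next
    case (Suc m)
    then show ?case
      using partial_sum_step(1,2)[of m "s m" "f (m + 1)" "f m"] s_nonneg[of m] f[of m] f[of "m + 1"] f_eq[of m]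
        s_Suc[of m] by (simp add: add.commute)
  qed
  \<comment> \<open>Convergence at the threshold 1 is enough: by the invariant, \<open>f n\<close>
    below 1 means \<open>s n\<close> below \<open>n\<close>.\<close>
  have "(SUP n\<in>{1..}. \<phi> (f n) (Opens {..<1})) = top"
    using assms by (simp add: good_sequence_def decreases_to_def rep_0)
  moreover have "\<phi> (f n) (Opens {..<1}) \<le> \<phi> (s n) (Opens {..<real n})" if "1 \<le> n" for n
    using inv[OF that]
    by (auto intro!: represents_le[OF _ represents_self represents_differ_null[OF represents_self represents_self]])
  ultimately have "(SUP n\<in>{1..}. \<phi> (partial_sums f n) (Opens {..<real n})) = top"
    by (intro top_le) (auto simp: s_eq intro!: SUP_mono elim!: subst)
  moreover have "partial_sums f m = inf_nat (partial_sums f (m + 1)) m" if "1 \<le> m" for m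
    unfolding s_eq[OF that] s_eq[OF le_add2] using partial_sum_step(3)[of m "s m" "f (m + 1)" "f m"] inv[OF that] that s_nonneg[of m] f[of m]
      f[of "m + 1"] f_eq[of m] s_Suc[of m] by simp
  moreover have "partial_sums f \<in> {1..} \<rightarrow>\<^sub>E {x. 0 \<le> x}"
    by (simp add: PiE_iff s_eq s_nonneg) (simp add: partial_sums_def)
  ultimately show ?thesis
    unfolding truncation_sequence_def by blast
qed

end

section \<open>The two passages are mutually inverse\<close>

text \<open>The sum telescopes; extensionality settles the index 0.\<close>

lemma partial_sums_differences:
  assumes "g \<in> extensional {1..}"
  shows "partial_sums (differences g) = g"
proof (rule extensionalityI[OF _ assms])
  show "partial_sums (differences g) \<in> extensional {1..}"
    by (simp add: partial_sums_def)
  fix m :: nat assume "m \<in> {1..}"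
  then have "1 \<le> m"
    by simp
  then have "(\<Sum>n=1..m. differences g n) = g m"
    by (induction m rule: nat_induct_at_least) (simp_all add: differences_def)
  then show "partial_sums (differences g) m = g m"
    using \<open>1 \<le> m\<close> by (simp add: partial_sums_def)
qed

lemma differences_partial_sums:
  assumes "f \<in> extensional {1..}"
  shows "differences (partial_sums f) = f"
proof (rule extensionalityI[OF _ assms])
  show "differences (partial_sums f) \<in> extensional {1..}"
    by (simp add: differences_def)
  fix m :: nat assume "m \<in> {1..}"
  then obtain k where "m = Suc k"
    by (cases m) auto
  \<comment> \<open>\<open>k = 0\<close> is the index 1, where the subtracted term is 0 by
    convention.\<close>
  then show "differences (partial_sums f) m = f m"
    by (cases k) (simp_all add: differences_def partial_sums_def)
qed

theorem proposition5p2p3: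
  fixes \<phi> :: "'g::trunc \<Rightarrow> real opens \<Rightarrow> 'l::pointed_frame"
    and q :: "'m::pointed_frame \<Rightarrow> 'l"
    and ext :: "'g \<Rightarrow> ereal opens \<Rightarrow> 'm"
  assumes "madden_representation \<phi> q ext"
  shows "(\<forall>g. truncation_sequence \<phi> g \<longrightarrow> good_sequence \<phi> (differences g)) \<and>
         (\<forall>f. good_sequence \<phi> f \<longrightarrow> truncation_sequence \<phi> (partial_sums f)) \<and>
         bij_betw differences {g. truncation_sequence \<phi> g} {f. good_sequence \<phi> f} \<and>
         (\<forall>g. truncation_sequence \<phi> g \<longrightarrow> partial_sums (differences g) = g) \<and>
         (\<forall>f. good_sequence \<phi> f \<longrightarrow> differences (partial_sums f) = f)"
proof -
  interpret madden_representation \<phi> q ext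
    by fact
  have ps: "partial_sums (differences g) = g" if "truncation_sequence \<phi> g" for g
    using that by (intro partial_sums_differences) (auto simp: truncation_sequence_def PiE_def)
  have df: "differences (partial_sums f) = f" if "good_sequence \<phi> f" for f
    using that by (intro differences_partial_sums) (auto simp: good_sequence_def PiE_def)
  have "bij_betw differences {g. truncation_sequence \<phi> g} {f. good_sequence \<phi> f}"
    by (rule bij_betw_byWitness[where f' = partial_sums])
      (auto simp: ps df good_differences truncation_partial_sums)
  then show ?thesis
    using good_differences truncation_partial_sums ps df by blast
qed

end
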